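(* Let $n\geq 3$ and let $D_n=\langle r,s\mid r^n=s^2=rsrs=e\rangle$ be the dihedral group of order $2n$. In the three-player game $\texttt{REL}_3(D_n,\{r,s\})$, Player 1 has a winning strategy if $n$ is odd, and Player 3 has a winning strategy if $n$ is even.
   Context: Game $\texttt{REL}_3(G,S)$: $G$ is a finite group and $S$ a generating set with $e\notin S$. Three players take turns in the cyclic order Player 1, Player 2, Player 3, Player 1, and so on, starting from the empty word $w_0$. On turn $n$ the current player chooses $s_n\in S\cup S^{-1}$, subject to $s_n\neq s_{n-1}^{-1}$ when $n>1$, and forms $w_n=w_{n-1}s_n$. The first player to form a word $w_n$ representing the same element of $G$ as some earlier $w_k$ ($0\le k<n$) finishes first (wins). The player whose turn would come next finishes second (runner-up), and the remaining player finishes third. Each player plays to obtain the best possible finishing position: a player who cannot ensure a win plays so that the opponent whose win gives them second place is the one who wins. *)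

theory Defs
  imports "HOL-Algebra.Algebra"
begin

section \<open>The three-player relator achievement game\<close>

text \<open>
  The game is played on a finite group \<open>G\<close> with a generating set \<open>S\<close> not containing the identity.
  A position is the word formed so far, given as the list of its letters in the order in which they
  were played. Players are numbered 1, 2, 3.
\<close>

definition word_value :: "('a, 'b) monoid_scheme \<Rightarrow> 'a list \<Rightarrow> 'a"
  where "word_value G w = foldl (\<otimes>\<^bsub>G\<^esub>) \<one>\<^bsub>G\<^esub> w"

definition moves :: "('a, 'b) monoid_scheme \<Rightarrow> 'a set \<Rightarrow> 'a list \<Rightarrow> 'a set"
  where "moves G S w =
    {x \<in> S \<union> (\<lambda>y. inv\<^bsub>G\<^esub> y) ` S. w \<noteq> [] \<longrightarrow> x \<noteq> inv\<^bsub>G\<^esub> (last w)}"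

definition game_over :: "('a, 'b) monoid_scheme \<Rightarrow> 'a list \<Rightarrow> bool"
  where "game_over G w \<longleftrightarrow> (\<exists>k < length w. word_value G (take k w) = word_value G w)"

definition next_player :: "nat \<Rightarrow> nat"
  where "next_player p = p mod 3 + 1"

definition to_move :: "'a list \<Rightarrow> nat"
  where "to_move w = length w mod 3 + 1"

text \<open>The winner of a finished game is the player who appended the last letter.\<close>

definition winner :: "'a list \<Rightarrow> nat"
  where "winner w = to_move (butlast w)"

text \<open>The finishing position (1, 2 or 3) of player \<open>q\<close> when player \<open>p\<close> wins.\<close>

definition place :: "nat \<Rightarrow> nat \<Rightarrow> nat"
  where "place p q = (if q = p then 1 else if q = next_player p then 2 else 3)"

text \<open>
  \<open>best_play G S w p\<close>: from position \<open>w\<close> on, player \<open>p\<close> wins if all three players play to obtain the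
  best possible finishing position (backward induction). The three finishing positions of a player
  correspond to three different winners, so the players' preferences are strict and there is at most
  one such \<open>p\<close>. Plays are finite since \<open>G\<close> is finite. Positions without any move, which do not occur
  for dihedral groups of order at least 6, get no winner.
\<close>

inductive best_play :: "('a, 'b) monoid_scheme \<Rightarrow> 'a set \<Rightarrow> 'a list \<Rightarrow> nat \<Rightarrow> bool"
  for G and S where
  over: "game_over G w \<Longrightarrow> best_play G S w (winner w)"
| move: "\<lbrakk> \<not> game_over G w; x \<in> moves G S w; best_play G S (w @ [x]) p;
      \<forall>y \<in> moves G S w. \<exists>q. best_play G S (w @ [y]) q \<and>
        place p (to_move w) \<le> place q (to_move w) \<rbrakk>
    \<Longrightarrow> best_play G S w p"

text \<open>The moves by which the player to move obtains the best finishing position available.\<close>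

definition best_moves :: "('a, 'b) monoid_scheme \<Rightarrow> 'a set \<Rightarrow> 'a list \<Rightarrow> 'a set"
  where "best_moves G S w =
    {x \<in> moves G S w. \<exists>p. best_play G S (w @ [x]) p \<and>
      (\<forall>y \<in> moves G S w. \<exists>q. best_play G S (w @ [y]) q \<and>
        place p (to_move w) \<le> place q (to_move w))}"

text \<open>
  A strategy assigns a letter to every position. \<open>wins_with G S p f w\<close>: if player \<open>p\<close> follows the
  strategy \<open>f\<close> from position \<open>w\<close> on and the two opponents play for their best finishing positions,
  then, whichever of their best moves they choose, \<open>p\<close> makes only legal moves and the game ends after
  finitely many turns with \<open>p\<close> as the winner.
\<close>

inductive wins_with ::
  "('a, 'b) monoid_scheme \<Rightarrow> 'a set \<Rightarrow> nat \<Rightarrow> ('a list \<Rightarrow> 'a) \<Rightarrow> 'a list \<Rightarrow> bool"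
  for G and S and p and f where
  over: "\<lbrakk> game_over G w; winner w = p \<rbrakk> \<Longrightarrow> wins_with G S p f w"
| own_move: "\<lbrakk> \<not> game_over G w; to_move w = p; f w \<in> moves G S w;
      wins_with G S p f (w @ [f w]) \<rbrakk>
    \<Longrightarrow> wins_with G S p f w"
| opponent_move: "\<lbrakk> \<not> game_over G w; to_move w \<noteq> p; best_moves G S w \<noteq> {};
      \<forall>x \<in> best_moves G S w. wins_with G S p f (w @ [x]) \<rbrakk>
    \<Longrightarrow> wins_with G S p f w"

definition has_winning_strategy :: "('a, 'b) monoid_scheme \<Rightarrow> 'a set \<Rightarrow> nat \<Rightarrow> bool"
  where "has_winning_strategy G S p \<longleftrightarrow> (\<exists>f. wins_with G S p f [])"


section \<open>Dihedral groups\<close>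

text \<open>
  \<open>G\<close> is the dihedral group of order \<open>2 n\<close> with presentation
  \<open>\<langle>r, s | r\<^sup>n = s\<^sup>2 = r s r s = e\<rangle>\<close>. A group generated by \<open>r\<close> and \<open>s\<close> which satisfies the relations
  is a quotient of the presented group, which has order \<open>2 n\<close>; the condition on the order says that
  it is the whole presented group and not a proper quotient.
\<close>

locale dihedral_group = group G for G (structure) +
  fixes n :: nat and r s :: 'a
  assumes r_closed: "r \<in> carrier G"
    and s_closed: "s \<in> carrier G"
    and generators: "generate G {r, s} = carrier G"
    and r_pow: "r [^] n = \<one>"
    and s_pow: "s [^] (2::nat) = \<one>"
    and rsrs: "r \<otimes> s \<otimes> r \<otimes> s = \<one>"
    and order: "order G = 2 * n"

text \<open>Such groups exist: the pair \<open>(i, b)\<close> stands for \<open>r\<^sup>i\<close> or \<open>r\<^sup>i s\<close> according to \<open>b\<close>.\<close>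

definition dihedral :: "nat \<Rightarrow> (int \<times> bool) monoid"
  where "dihedral n = \<lparr>carrier = {0..<int n} \<times> UNIV,
    monoid.mult = (\<lambda>(i, b) (j, c). ((if b then i - j else i + j) mod int n, b \<noteq> c)),
    monoid.one = (0, False)\<rparr>"

lemma dihedral_group_dihedral:
  assumes "n \<ge> 2"
  shows "dihedral_group (dihedral n) n (1, False) (0, True)"
proof -
  let ?G = "dihedral n"
  have n: "int n > 1" using assms by simp
  have grp: "group ?G"
  proof (rule groupI)
    fix x assume x: "x \<in> carrier ?G"
    obtain i b where ib: "x = (i, b)" by (cases x)
    show "\<exists>y\<in>carrier ?G. y \<otimes>\<^bsub>?G\<^esub> x = \<one>\<^bsub>?G\<^esub>"
    proof (cases b)
      case True
      then show ?thesis using x ib by (intro bexI[of _ x]) (auto simp: dihedral_def)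
    next
      case False
      have "((- i) mod int n + i) mod int n = 0" by (simp add: mod_simps)
      then show ?thesis using ib n False
        by (intro bexI[of _ "((- i) mod int n, False)"]) (auto simp: dihedral_def)
    qed
  next
    fix x y z assume "x \<in> carrier ?G" "y \<in> carrier ?G" "z \<in> carrier ?G"
    show "x \<otimes>\<^bsub>?G\<^esub> y \<otimes>\<^bsub>?G\<^esub> z = x \<otimes>\<^bsub>?G\<^esub> (y \<otimes>\<^bsub>?G\<^esub> z)"
      by (auto simp: dihedral_def mod_simps algebra_simps split: prod.splits)
  qed (use n in \<open>auto simp: dihedral_def split: prod.splits\<close>)
  interpret group ?G by (rule grp)
  have mem: "(1, False) \<in> carrier ?G" "(0, True) \<in> carrier ?G"
    using n by (auto simp: dihedral_def)
  have pow: "(1, False) [^]\<^bsub>?G\<^esub> k = (int k mod int n, False)" for k :: nat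
    using n by (induction k) (auto simp: dihedral_def mod_simps add.commute)
  have gen: "x \<in> generate ?G {(1, False), (0, True)}" if x: "x \<in> carrier ?G" for x
  proof -
    let ?H = "generate ?G {(1, False), (0, True)}"
    interpret H: subgroup ?H ?G by (rule generate_is_subgroup) (use mem in auto)
    have r: "(1, False) \<in> ?H" and s: "(0, True) \<in> ?H" by (auto intro: generate.incl)
    have "(1, False) [^]\<^bsub>?G\<^esub> k \<in> ?H" for k :: nat
      by (induction k) (auto intro: r)
    then have p: "(i, False) \<in> ?H" if "0 \<le> i" "i < int n" for i
      using that pow[of "nat i"] by (metis int_nat_eq mod_pos_pos_trivial)
    have "(i, True) \<in> ?H" if "0 \<le> i" "i < int n" for i
      using H.m_closed[OF p[OF that] s] that by (simp add: dihedral_def)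
    with p x show ?thesis by (cases x; cases "snd x") (auto simp: dihedral_def)
  qed
  show ?thesis
  proof
    show "generate ?G {(1, False), (0, True)} = carrier ?G"
      using gen mem generate_incl[of "{(1, False), (0, True)}"] by blast
    show "(1, False) [^]\<^bsub>?G\<^esub> n = \<one>\<^bsub>?G\<^esub>" by (simp add: pow) (simp add: dihedral_def)
    show "order ?G = 2 * n"
      by (simp add: order_def dihedral_def card_cartesian_product card_UNIV_bool)
  qed (use mem n in \<open>auto simp: dihedral_def numeral_2_eq_2\<close>)
qed

end

theory Submission
  imports Defs
begin

text \<open>
  The Cayley graph is a prism, and a play is a walk in it. A player who turns back after a rung, or
  who takes two rungs in neighbouring columns, lets the next player close a 4-cycle, which is the
  worst outcome for that player. So the walk runs around the prism in one direction, and a position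
  is described by the number of columns left, the current row and the number of steps since the last
  rung. Backward induction over these data gives values that are periodic in the number of columns
  left: with period 2 if the first move is a rung, and otherwise with period 2 up to swapping the
  rows.
\<close>

section \<open>Values of positions\<close>

text \<open>All prefixes count, the full word included, so \<open>game_over\<close> becomes a
  membership test that can be updated letter by letter.\<close>

definition visited :: "('a, 'b) monoid_scheme \<Rightarrow> 'a list \<Rightarrow> 'a set"
  where "visited G w = (\<lambda>k. word_value G (take k w)) ` {..length w}"

lemma word_value_Nil [simp]: "word_value G [] = \<one>\<^bsub>G\<^esub>"
  by (simp add: word_value_def)

lemma word_value_snoc [simp]: "word_value G (w @ [x]) = word_value G w \<otimes>\<^bsub>G\<^esub> x"
  by (simp add: word_value_def)

lemma visited_Nil [simp]: "visited G [] = {\<one>\<^bsub>G\<^esub>}"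
  by (simp add: visited_def)

lemma visited_snoc [simp]:
  "visited G (w @ [x]) = insert (word_value G w \<otimes>\<^bsub>G\<^esub> x) (visited G w)"
proof -
  have "{..length (w @ [x])} = insert (Suc (length w)) {..length w}"
    by auto
  then have "visited G (w @ [x]) = insert (word_value G (w @ [x]))
      ((\<lambda>k. word_value G (take k (w @ [x]))) ` {..length w})"
    unfolding visited_def by simp
  also have "(\<lambda>k. word_value G (take k (w @ [x]))) ` {..length w} = visited G w"
    unfolding visited_def by (intro image_cong) auto
  finally show ?thesis
    by simp
qed

lemma word_value_visited [simp]: "word_value G w \<in> visited G w"
  unfolding visited_def by (intro image_eqI[of _ _ "length w"]) auto

lemma game_over_Nil [simp]: "\<not> game_over G []"
  by (simp add: game_over_def)

lemma game_over_snoc [simp]: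
  "game_over G (w @ [x]) \<longleftrightarrow> word_value G w \<otimes>\<^bsub>G\<^esub> x \<in> visited G w"
  unfolding game_over_def visited_def by (force simp: less_Suc_eq_le)

lemma winner_snoc [simp]: "winner (w @ [x]) = to_move w"
  by (simp add: winner_def)

lemma to_move_range: "to_move w \<in> {1, 2, 3}"
  by (auto simp: to_move_def)

lemma best_play_range: "best_play G S w p \<Longrightarrow> p \<in> {1, 2, 3}"
  by (induction rule: best_play.induct) (use to_move_range in \<open>auto simp: winner_def\<close>)

lemma place_inject:
  assumes "place p m = place q m" "p \<in> {1, 2, 3}" "q \<in> {1, 2, 3}" "m \<in> {1, 2, 3}"
  shows "p = q"
proof -
  have "p = 1 \<or> p = 2 \<or> p = 3" "q = 1 \<or> q = 2 \<or> q = 3" "m = 1 \<or> m = 2 \<or> m = 3"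
    using assms by auto
  then show ?thesis
    using assms(1) by (elim disjE) (simp_all add: place_def next_player_def)
qed

text \<open>Two derivations may choose different moves, but the optimality condition of each bounds
  its place by that of the other. Equal places mean equal winners, as preferences are
  strict.\<close>

lemma best_play_unique:
  assumes "best_play G S w p" "best_play G S w p'"
  shows "p = p'"
  using assms
proof (induction arbitrary: p' rule: best_play.induct)
  case (over w)
  from over(2) over(1) show ?case
    by (cases rule: best_play.cases) auto
next
  case (move w x p)
  \<comment> \<open>Reassembled from the induction hypotheses; it supplies the range of
    \<open>p\<close> that \<open>place_inject\<close> demands.\<close>
  have p: "best_play G S w p"
  proof (rule best_play.move[OF move.hyps(1,2)])
    show "best_play G S (w @ [x]) p" by (rule move.hyps(3))
    show "\<forall>y\<in>moves G S w. \<exists>q. best_play G S (w @ [y]) q \<and>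
        place p (to_move w) \<le> place q (to_move w)"
      using move.IH(2) by fast
  qed
  from move.prems show ?case
  proof (cases rule: best_play.cases)
    case over
    with move show ?thesis by blast
  next
    case (move x')
    have "place p (to_move w) \<le> place p' (to_move w)"
      using move move.IH(2) by blast
    moreover have "place p' (to_move w) \<le> place p (to_move w)"
      using move move.IH(1) \<open>x \<in> moves G S w\<close> by blast
    ultimately show ?thesis
      using place_inject best_play_range p move.prems to_move_range by (metis antisym)
  qed
qed

text \<open>Relative to the player to move, \<open>0\<close> is that player, \<open>1\<close> the next one, and \<open>2\<close> the previous one.\<close>

definition has_value :: "('a, 'b) monoid_scheme \<Rightarrow> 'a set \<Rightarrow> 'a list \<Rightarrow> nat \<Rightarrow> bool"
  where "has_value G S w v \<longleftrightarrow> best_play G S w ((length w + v) mod 3 + 1)"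

text \<open>If the previous player wins (\<open>v = 2\<close>), the mover is next in turn and comes
  second.\<close>

lemma place_shift:
  assumes "v < 3"
  shows "place ((l + v) mod 3 + 1) (l mod 3 + 1) = (if v = 0 then 1 else if v = 2 then 2 else 3)"
proof -
  have l: "l mod 3 = 0 \<or> l mod 3 = 1 \<or> l mod 3 = 2" by arith
  have v: "v = 0 \<or> v = 1 \<or> v = 2" using assms by arith
  have "(l + v) mod 3 = (l mod 3 + v) mod 3" by (simp add: mod_simps)
  with l v show ?thesis
    by (elim disjE) (simp_all add: place_def next_player_def)
qed

lemma has_value_over:
  assumes "game_over G (w @ [x])"
  shows "has_value G S (w @ [x]) 2"
proof -
  have "(length (w @ [x]) + 2) mod 3 + 1 = winner (w @ [x])"
    by (simp add: to_move_def mod_simps)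
  with best_play.over[OF assms] show ?thesis
    unfolding has_value_def by metis
qed

text \<open>The player to move likes best the successors of value \<open>2\<close>, then those of value \<open>1\<close>.\<close>

lemma has_value_step:
  assumes nov: "\<not> game_over G w"
    and x: "x \<in> moves G S w" "has_value G S (w @ [x]) v" "v < 3"
    and y: "\<And>y. y \<in> moves G S w \<Longrightarrow> \<exists>u\<le>v. has_value G S (w @ [y]) u"
  shows "has_value G S w ((v + 1) mod 3)"
proof -
  \<comment> \<open>One turn shifts relative numbers by one: successor values 2, 1, 0 become 0, 2, 1
    for the mover, that is first, second and third place. So larger successor values are
    better.\<close>
  have eq: "(length w + (u + 1) mod 3) mod 3 + 1 = (length (w @ [z]) + u) mod 3 + 1" for u z
    by (simp add: mod_simps)
  have "best_play G S w ((length w + (v + 1) mod 3) mod 3 + 1)"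
  proof (rule best_play.move[OF nov x(1)], safe)
    show "best_play G S (w @ [x]) ((length w + (v + 1) mod 3) mod 3 + 1)"
      using x(2) unfolding has_value_def eq[of _ x] .
  next
    fix y assume "y \<in> moves G S w"
    then obtain u where u: "u \<le> v" "has_value G S (w @ [y]) u" using y by blast
    have "place ((length w + (v + 1) mod 3) mod 3 + 1) (to_move w)
          \<le> place ((length w + (u + 1) mod 3) mod 3 + 1) (to_move w)"
    proof -
      have "v = 0 \<or> v = 1 \<or> v = 2" "u = 0 \<or> u = 1 \<or> u = 2" using u x(3) by arith+
      with u(1) show ?thesis
        unfolding to_move_def by (subst (1 2) place_shift) auto
    qed
    with u(2) show "\<exists>q. best_play G S (w @ [y]) q \<and>
        place ((length w + (v + 1) mod 3) mod 3 + 1) (to_move w) \<le> place q (to_move w)"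
      unfolding has_value_def eq[of _ y] by blast
  qed
  then show ?thesis unfolding has_value_def .
qed

lemma has_value_two_moves:
  assumes "\<not> game_over G w" "moves G S w = {x, y}"
    and "has_value G S (w @ [x]) u" "u < 3" "has_value G S (w @ [y]) v" "v < 3"
  shows "has_value G S w ((max u v + 1) mod 3)"
proof (cases "u \<le> v")
  case True
  then have "has_value G S w ((v + 1) mod 3)"
    using assms by (intro has_value_step[where x = y]) auto
  with True show ?thesis by (simp add: max_def)
next
  case False
  then have "has_value G S w ((u + 1) mod 3)"
    using assms by (intro has_value_step[where x = x]) (auto intro: less_imp_le exI[of _ v])
  with False show ?thesis by (simp add: max_def)
qed

section \<open>Existence of values and of winning strategies\<close>

context group
begin

lemma word_value_closed: "set w \<subseteq> carrier G \<Longrightarrow> word_value G w \<in> carrier G"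
  by (induction w rule: rev_induct) auto

lemma visited_closed: "set w \<subseteq> carrier G \<Longrightarrow> visited G w \<subseteq> carrier G"
  by (induction w rule: rev_induct) (auto intro: word_value_closed)

lemma moves_closed: "S \<subseteq> carrier G \<Longrightarrow> moves G S w \<subseteq> carrier G"
  by (auto simp: moves_def)

text \<open>A letter that does not end the game visits a new element, so the number of unvisited
  elements drops.\<close>

lemma word_induct [consumes 2, case_names word]:
  assumes fin: "finite (carrier G)" and w: "set w \<subseteq> carrier G"
    and step: "\<And>w. set w \<subseteq> carrier G \<Longrightarrow>
      (\<And>x. x \<in> carrier G \<Longrightarrow> \<not> game_over G (w @ [x]) \<Longrightarrow> Q (w @ [x])) \<Longrightarrow> Q w"
  shows "Q w"
  using w
proof (induction "card (carrier G) - card (visited G w)" arbitrary: w rule: less_induct)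
  case less
  show ?case
  proof (rule step[OF less.prems])
    fix x assume x: "x \<in> carrier G" "\<not> game_over G (w @ [x])"
    have wx: "set (w @ [x]) \<subseteq> carrier G" using less.prems x by auto
    have "visited G w \<subset> visited G (w @ [x])" using x(2) by auto
    with visited_closed[OF wx] fin
    have "card (visited G w) < card (visited G (w @ [x]))"
      "card (visited G (w @ [x])) \<le> card (carrier G)"
      by (auto intro!: psubset_card_mono card_mono dest: finite_subset)
    then show "Q (w @ [x])" using less.hyps[OF _ wx] by linarith
  qed
qed

lemma best_play_exists:
  assumes fin: "finite (carrier G)" and S: "S \<subseteq> carrier G"
    and mv: "\<And>w. moves G S w \<noteq> {}" and w: "set w \<subseteq> carrier G"
  shows "\<exists>p. best_play G S w p"
  using fin w
proof (induction rule: word_induct)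
  case (word w)
  show ?case
  proof (cases "game_over G w")
    case True
    then show ?thesis by (blast intro: best_play.over)
  next
    case False
    have "\<exists>q. best_play G S (w @ [y]) q" if "y \<in> moves G S w" for y
      using word.IH[of y] that moves_closed[OF S] best_play.over by blast
    then obtain q where q: "best_play G S (w @ [y]) (q y)" if "y \<in> moves G S w" for y
      by metis
    obtain x where x: "x \<in> moves G S w"
      "\<And>y. y \<in> moves G S w \<Longrightarrow> place (q x) (to_move w) \<le> place (q y) (to_move w)"
      using mv[of w] ex_has_least_nat[of "\<lambda>x. x \<in> moves G S w" _ "\<lambda>x. place (q x) (to_move w)"]
      by blast
    then show ?thesis using False q best_play.move by metis
  qed
qed

text \<open>The strategy picks any best move. By uniqueness of the winner every best move, own or
  hostile, leads to a position that \<open>p\<close> still wins.\<close>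

lemma best_play_imp_wins_with:
  assumes fin: "finite (carrier G)" and S: "S \<subseteq> carrier G"
    and w: "set w \<subseteq> carrier G" and bp: "best_play G S w p"
  shows "wins_with G S p (\<lambda>w. SOME x. x \<in> best_moves G S w) w"
  using fin w bp
proof (induction rule: word_induct)
  case (word w)
  let ?f = "\<lambda>w. SOME x. x \<in> best_moves G S w"
  show ?case
  proof (cases "game_over G w")
    case True
    then show ?thesis
      using word.prems best_play.over best_play_unique wins_with.over by metis
  next
    case False
    from word.prems False obtain x where x: "x \<in> moves G S w" "best_play G S (w @ [x]) p"
      "\<forall>y\<in>moves G S w. \<exists>q. best_play G S (w @ [y]) q \<and> place p (to_move w) \<le> place q (to_move w)"
      by (auto elim: best_play.cases)
    then have ne: "best_moves G S w \<noteq> {}" unfolding best_moves_def by blast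
    have good: "wins_with G S p ?f (w @ [y])" if y: "y \<in> best_moves G S w" for y
    proof -
      obtain q where "y \<in> moves G S w" "best_play G S (w @ [y]) q"
        "\<forall>y\<in>moves G S w. \<exists>q'. best_play G S (w @ [y]) q' \<and> place q (to_move w) \<le> place q' (to_move w)"
        using y unfolding best_moves_def by blast
      then have "best_play G S w q" using False best_play.move by metis
      then have "q = p" using word.prems best_play_unique by metis
      then have bp: "best_play G S (w @ [y]) p" using \<open>best_play G S (w @ [y]) q\<close> by simp
      show ?thesis
      proof (cases "game_over G (w @ [y])")
        case True
        then show ?thesis using bp best_play.over best_play_unique wins_with.over by metis
      next
        case False
        then show ?thesis
          using word.IH bp \<open>y \<in> moves G S w\<close> moves_closed[OF S] by blast
      qed
    qed
    have f: "?f w \<in> best_moves G S w" using ne by (simp add: some_in_eq)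
    show ?thesis
    proof (cases "to_move w = p")
      case True
      have "?f w \<in> moves G S w" using f unfolding best_moves_def by blast
      then show ?thesis using wins_with.own_move[OF False True] good[OF f] by simp
    next
      case neq: False
      then show ?thesis using wins_with.opponent_move[OF False neq ne] good by blast
    qed
  qed
qed

end

section \<open>The dihedral group as a prism\<close>

context dihedral_group
begin

definition vertex :: "nat \<Rightarrow> bool \<Rightarrow> 'a"
  where "vertex i a = r [^] i \<otimes> (if a then s else \<one>)"

text \<open>Row \<open>True\<close> consists of the elements \<open>r [^] i \<otimes> s\<close>;
  moving \<open>r\<close> past \<open>s\<close> inverts it, so there \<open>inv r\<close> raises the
  column.\<close>

definition forward :: "bool \<Rightarrow> 'a"
  where "forward a = (if a then inv r else r)"

lemma closed [simp, intro]: "r \<in> carrier G" "s \<in> carrier G" "forward a \<in> carrier G"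
  using r_closed s_closed by (auto simp: forward_def)

lemma vertex_closed [simp, intro]: "vertex i a \<in> carrier G"
  by (auto simp: vertex_def)

lemma s_s [simp]: "s \<otimes> s = \<one>"
  using s_pow by (simp add: numeral_2_eq_2)

lemma inv_s [simp]: "inv s = s"
  by (simp add: inv_equality)

text \<open>The relation makes \<open>r \<otimes> s\<close> an involution, hence equal to its
  inverse \<open>s \<otimes> inv r\<close>.\<close>

lemma s_inv_r: "s \<otimes> inv r = r \<otimes> s"
proof -
  have "(r \<otimes> s) \<otimes> (r \<otimes> s) = \<one>" using rsrs by (simp add: m_assoc)
  then have "inv (r \<otimes> s) = r \<otimes> s" by (simp add: inv_equality)
  then show ?thesis by (simp add: inv_mult_group)
qed

lemma vertex_0 [simp]: "vertex 0 False = \<one>"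
  by (simp add: vertex_def)

lemma vertex_s [simp]: "vertex i a \<otimes> s = vertex i (\<not> a)"
  by (simp add: vertex_def m_assoc)

lemma vertex_forward [simp]: "vertex i a \<otimes> forward a = vertex (Suc i) a"
  by (simp add: vertex_def forward_def m_assoc s_inv_r)

lemma vertex_backward: "vertex (Suc i) a \<otimes> inv (forward a) = vertex i a"
  by (simp add: m_assoc flip: vertex_forward)

lemma vertex_n: "vertex n a = vertex 0 a"
  using r_pow by (simp add: vertex_def)

text \<open>The vertices are closed under right multiplication by the generators and their inverses,
  so they fill the group; its order \<open>2 * n\<close> then leaves no room for
  coincidences.\<close>

lemma vertex_inj_on:
  assumes "n > 0"
  shows "inj_on (\<lambda>(i, a). vertex i a) ({..<n} \<times> UNIV)"
proof -
  let ?H = "(\<lambda>(i, a). vertex i a) ` ({..<n} \<times> UNIV)"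
  have fw: "vertex i a \<otimes> forward a \<in> ?H" if "i < n" for i a
  proof (cases "Suc i < n")
    case True
    then show ?thesis by force
  next
    case False
    then have "Suc i = n" using that by simp
    then show ?thesis using assms vertex_n by force
  qed
  have bw: "vertex i a \<otimes> inv (forward a) \<in> ?H" if "i < n" for i a
  proof (cases i)
    case 0
    have "vertex i a \<otimes> inv (forward a) = vertex (n - 1) a"
      using assms 0 vertex_backward[of "n - 1" a] vertex_n by simp
    then show ?thesis using assms by force
  next
    case (Suc j)
    then show ?thesis using that vertex_backward by force
  qed
  have r: "vertex i a \<otimes> r \<in> ?H" "vertex i a \<otimes> inv r \<in> ?H" if "i < n" for i a
    using fw[OF that, of a] bw[OF that, of a] by (cases a; simp add: forward_def)+
  have s: "vertex i a \<otimes> s \<in> ?H" if "i < n" for i a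
    using that by force
  have mult: "h \<otimes> x \<in> ?H" if "x \<in> generate G {r, s}" "h \<in> ?H" for x h
    using that
  proof (induction arbitrary: h rule: generate.induct)
    case one
    then have "h \<in> carrier G" by auto
    with one show ?case by simp
  next
    case (incl x)
    then show ?case using r s by auto
  next
    case (inv x)
    then show ?case using r s by auto
  next
    case (eng x y)
    have "x \<in> carrier G" "y \<in> carrier G" "h \<in> carrier G"
      using eng generators by auto
    then show ?case using eng by (simp flip: m_assoc)
  qed
  have "\<one> \<in> ?H" using assms by (intro image_eqI[of _ _ "(0, False)"]) auto
  then have "x \<in> ?H" if "x \<in> carrier G" for x
    using mult[of x "\<one>"] generators that by simp
  moreover have "?H \<subseteq> carrier G" by auto
  ultimately have "?H = carrier G" by blast
  then have "card ?H = card ({..<n} \<times> (UNIV :: bool set))"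
    using order by (simp add: order_def card_cartesian_product card_UNIV_bool)
  then show ?thesis by (intro eq_card_imp_inj_on) auto
qed

lemma vertex_eq_iff:
  assumes "i < n" "j < n"
  shows "vertex i a = vertex j b \<longleftrightarrow> i = j \<and> a = b"
  using inj_onD[OF vertex_inj_on, of "(i, a)" "(j, b)"] assms by auto

lemma letters_distinct:
  assumes "n \<ge> 3"
  shows "r \<noteq> s" "inv r \<noteq> s" "r \<noteq> inv r" "inv r \<noteq> r"
proof -
  have "r = vertex 1 False" "s = vertex 0 True" "r \<otimes> r = vertex 2 False" "\<one> = vertex 0 False"
    by (simp_all add: vertex_def numeral_2_eq_2)
  then have *: "r \<noteq> s" "r \<otimes> r \<noteq> \<one>"
    using vertex_eq_iff[of 1 0 False True] vertex_eq_iff[of 2 0 False False] assms by auto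
  show "r \<noteq> s" by (fact *)
  show "inv r \<noteq> s" using *(1) inv_s by (metis closed(1) inv_inv)
  show "r \<noteq> inv r" using *(2) by (metis closed(1) r_inv)
  then show "inv r \<noteq> r" by simp
qed

text \<open>This mirror symmetry transfers results on openings with \<open>r\<close> to those with
  \<open>inv r\<close>.\<close>

lemma dihedral_group_inv: "dihedral_group G n (inv r) s"
proof
  have sub: "subgroup (generate G {inv r, s}) G"
    by (rule generate_is_subgroup) auto
  have "inv r \<in> generate G {inv r, s}" "s \<in> generate G {inv r, s}"
    by (auto intro: generate.incl)
  with subgroup.m_inv_closed[OF sub, of "inv r"] have "{r, s} \<subseteq> generate G {inv r, s}"
    by simp
  from generate_subgroup_incl[OF this sub] show "generate G {inv r, s} = carrier G"
    using generators subgroup.subset[OF sub] by simp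
  show "inv r [^] n = \<one>" using r_pow by (simp add: nat_pow_inv)
  show "s [^] (2::nat) = \<one>" by (rule s_pow)
  show "inv r \<otimes> s \<otimes> inv r \<otimes> s = \<one>"
    by (simp add: m_assoc s_inv_r)
  show "order G = 2 * n" by (rule order)
qed auto

lemma letters_closed:
  assumes "S \<union> (\<lambda>y. inv y) ` S = {r, inv r, s}"
  shows "S \<subseteq> carrier G"
proof -
  have "S \<subseteq> {r, inv r, s}" using assms by blast
  then show ?thesis by auto
qed

text \<open>After a rung \<open>a\<close> is arbitrary, since either choice lists \<open>r\<close>
  and \<open>inv r\<close>.\<close>

lemma moves_after:
  assumes "n \<ge> 3" "S \<union> (\<lambda>y. inv y) ` S = {r, inv r, s}"
  shows "moves G S (w @ [s]) = {forward a, inv (forward a)}"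
    and "moves G S (w @ [forward a]) = {forward a, s}"
proof -
  show "moves G S (w @ [s]) = {forward a, inv (forward a)}"
    using letters_distinct[OF assms(1)] unfolding moves_def assms(2)
    by (cases a) (auto simp: forward_def)
  show "moves G S (w @ [forward a]) = {forward a, s}"
    using letters_distinct[OF assms(1)] unfolding moves_def assms(2)
    by (cases a) (auto simp: forward_def)
qed

lemma moves_Nil:
  assumes "S \<union> (\<lambda>y. inv y) ` S = {r, inv r, s}"
  shows "moves G S [] = {r, inv r, s}"
  unfolding moves_def assms by auto

lemma moves_not_empty:
  assumes "n \<ge> 3" "S \<union> (\<lambda>y. inv y) ` S = {r, inv r, s}"
  shows "moves G S w \<noteq> {}"
proof (cases "r = inv (last w)")
  case True
  then have "s \<in> moves G S w"
    using letters_distinct(1)[OF assms(1)] unfolding moves_def assms(2) by simp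
  then show ?thesis by blast
next
  case False
  then have "r \<in> moves G S w" unfolding moves_def assms(2) by simp
  then show ?thesis by blast
qed

lemma finite_carrier: "n > 0 \<Longrightarrow> finite (carrier G)"
  using order by (auto simp: order_def intro: card_ge_0_finite)

section \<open>Positions of a walk around the prism\<close>

text \<open>
  The word \<open>w\<close> ends at column \<open>i \<ge> 1\<close> in row \<open>a\<close> after a walk in increasing column order, and \<open>t\<close> is
  the number of steps since the last rung (counted as at least \<open>2\<close> if there was none). The flag \<open>c\<close>
  says whether the play began with a rung.
\<close>

definition walk :: "bool \<Rightarrow> 'a list \<Rightarrow> nat \<Rightarrow> bool \<Rightarrow> nat \<Rightarrow> bool"
  where "walk c w i a t \<longleftrightarrow>
    1 \<le> i \<and> i < n \<and> \<not> game_over G w \<and> word_value G w = vertex i a \<and>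
    (\<exists>v. w = v @ [if t = 0 then s else forward a]) \<and>
    (\<forall>j b. i < j \<longrightarrow> j < n \<longrightarrow> vertex j b \<notin> visited G w) \<and>
    vertex 0 False \<in> visited G w \<and> (vertex 0 True \<in> visited G w \<longleftrightarrow> c) \<and>
    (vertex i (\<not> a) \<in> visited G w \<longleftrightarrow> t = 0) \<and>
    (vertex (i - 1) (\<not> a) \<in> visited G w \<longleftrightarrow> t \<le> 1) \<and>
    (vertex (i - 1) a \<in> visited G w \<longleftrightarrow> t \<noteq> 0)"

lemma walk_end_visited: "walk c w i a t \<Longrightarrow> vertex i a \<in> visited G w"
  unfolding walk_def using word_value_visited by metis

lemma walk_forward:
  assumes "walk c w i a t" "Suc i < n"
  shows "walk c (w @ [forward a]) (Suc i) a (Suc t)"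
  using assms walk_end_visited[OF assms(1)]
  unfolding walk_def by (auto simp: vertex_eq_iff)

text \<open>The bound on \<open>t\<close> ensures that the vertex behind the new end is unvisited,
  as \<open>t = 0\<close> requires there.\<close>

lemma walk_rung:
  assumes "walk c w i a t" "t \<ge> 2"
  shows "walk c (w @ [s]) i (\<not> a) 0"
  using assms walk_end_visited[OF assms(1)]
  unfolding walk_def by (auto simp: vertex_eq_iff)

lemma walk_moves:
  assumes "n \<ge> 3" "S \<union> (\<lambda>y. inv y) ` S = {r, inv r, s}" "walk c w i a t"
  shows "moves G S w = {forward a, if t = 0 then inv (forward a) else s}"
proof -
  obtain v where "w = v @ [if t = 0 then s else forward a]"
    using assms(3) unfolding walk_def by blast
  then show ?thesis using moves_after[OF assms(1,2), of v a] by (cases "t = 0") auto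
qed

text \<open>A successor of value 2 cannot be beaten, so of the other moves only the existence of a
  value matters.\<close>

lemma has_value_winning:
  assumes n: "n \<ge> 3" and S: "S \<union> (\<lambda>y. inv y) ` S = {r, inv r, s}"
    and w: "set w \<subseteq> carrier G" and nov: "\<not> game_over G w"
    and x: "x \<in> moves G S w" "has_value G S (w @ [x]) 2"
  shows "has_value G S w 0"
proof -
  have Sc: "S \<subseteq> carrier G" using letters_closed[OF S] .
  have "\<exists>u\<le>2. has_value G S (w @ [y]) u" if y: "y \<in> moves G S w" for y
  proof -
    have "set (w @ [y]) \<subseteq> carrier G" using w y moves_closed[OF Sc] by auto
    then obtain p where p: "best_play G S (w @ [y]) p"
      using best_play_exists[OF finite_carrier Sc moves_not_empty[OF n S]] n by (meson less_le_trans zero_less_numeral)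
    define l where "l = length (w @ [y])"
    have "p = 1 \<or> p = 2 \<or> p = 3" using best_play_range[OF p] by auto
    moreover have "l mod 3 = 0 \<or> l mod 3 = 1 \<or> l mod 3 = 2" by arith
    ultimately have "\<exists>u\<le>2. p = (l + u) mod 3 + 1"
      by presburger
    with p show ?thesis unfolding has_value_def l_def by metis
  qed
  with has_value_step[OF nov x] show ?thesis by simp
qed

section \<open>Backward induction\<close>

text \<open>
  The value when \<open>d\<close> columns are left. At \<open>d = 0\<close> the walk is back in column 0: either it has been
  closed, or the next player closes it by a rung. A step backwards after a rung, and a second rung
  at \<open>t = 1\<close>, lead to a successor of value \<open>0\<close> and so do not matter for the maximum.
\<close>

fun walk_value :: "bool \<Rightarrow> nat \<Rightarrow> bool \<Rightarrow> nat \<Rightarrow> nat" where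
  "walk_value c 0 a t = (if a \<and> \<not> c then 0 else 2)"
| "walk_value c (Suc d) a 0 = (walk_value c d a 1 + 1) mod 3"
| "walk_value c (Suc d) a (Suc 0) = (walk_value c d a 2 + 1) mod 3"
| "walk_value c (Suc d) a (Suc (Suc t)) =
    (max (walk_value c d a 2) ((walk_value c d (\<not> a) 1 + 1) mod 3) + 1) mod 3"

lemma walk_value_less: "walk_value c d a t < 3"
  by (induction c d a t rule: walk_value.induct) auto

lemma walk_value_large: "t \<ge> 2 \<Longrightarrow> walk_value c d a t = walk_value c d a 2"
  by (cases d; cases t; cases "t - 1") (auto simp: numeral_2_eq_2)

lemma has_value_walk:
  assumes n: "n \<ge> 3" and S: "S \<union> (\<lambda>y. inv y) ` S = {r, inv r, s}"
  shows "walk c w i a t \<Longrightarrow> set w \<subseteq> carrier G \<Longrightarrow> i + d = n \<Longrightarrow> has_value G S w (walk_value c d a t)"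
proof (induction d arbitrary: w i a t)
  case 0
  then show ?case by (simp add: walk_def)
next
  case (Suc d)
  note closing = has_value_winning[OF n S _ _ _ has_value_over]
  have fw: "has_value G S (w @ [forward a]) (walk_value c d a (Suc t))"
    if w: "walk c w i a t" "set w \<subseteq> carrier G" for w a t
  proof (cases "d = 0")
    case False
    then show ?thesis
      using Suc.IH[OF walk_forward[OF w(1)]] w(2) Suc.prems(3) by auto
  next
    case True
    then have i: "Suc i = n" using Suc.prems(3) by simp
    have val: "word_value G w \<otimes> forward a = vertex 0 a"
      using w(1) i vertex_n unfolding walk_def by simp
    \<comment> \<open>Column 0 is reached. Its only vertex that can be unvisited is the one in row
      \<open>True\<close>, when no rung opened the play; from there the next player closes with
      \<open>s\<close> at the identity.\<close>
    show ?thesis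
    proof (cases "a \<and> \<not> c")
      case False
      have "game_over G (w @ [forward a])"
        using False w(1) unfolding game_over_snoc val walk_def by (cases a) auto
      then show ?thesis using False True has_value_over[of G w "forward a" S] by auto
    next
      case ac: True
      have "\<not> game_over G (w @ [forward a])"
        using ac w(1) unfolding game_over_snoc val walk_def by auto
      moreover have "s \<in> moves G S (w @ [forward a])"
        using moves_after(2)[OF n S] by simp
      moreover have "game_over G ((w @ [forward a]) @ [s])"
        using ac w(1) val unfolding walk_def by (simp del: append_assoc)
      ultimately show ?thesis using closing[of "w @ [forward a]" s] w(2) ac True by simp
    qed
  qed
  have nov: "\<not> game_over G w" if "walk c w i a t" for w a t
    using that unfolding walk_def by blast
  have at0: "has_value G S w (walk_value c (Suc d) a 0)"
    if w: "walk c w i a 0" "set w \<subseteq> carrier G" for w a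
  proof -
    let ?b = "inv (forward a)"
    obtain j where j: "i = Suc j" using w(1) unfolding walk_def by (cases i) auto
    have val: "word_value G w \<otimes> ?b = vertex j a"
      using w(1) j vertex_backward unfolding walk_def by simp
    have mv: "moves G S w = {forward a, ?b}" using walk_moves[OF n S w(1)] by simp
    \<comment> \<open>Turning back enters the unvisited vertex beside the column before the rung;
      the opponent's \<open>s\<close> then closes the 4-cycle.\<close>
    have "\<not> game_over G (w @ [?b])"
      using w(1) j unfolding game_over_snoc val walk_def by simp
    \<comment> \<open>The backward letter of row \<open>a\<close> is the forward letter of the other
      row.\<close>
    moreover have "s \<in> moves G S (w @ [?b])"
      using moves_after(2)[OF n S, of w "\<not> a"] by (cases a) (auto simp: forward_def)
    moreover have "game_over G ((w @ [?b]) @ [s])"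
      using w(1) j val unfolding walk_def by (simp del: append_assoc)
    ultimately have "has_value G S (w @ [?b]) 0" using closing[of "w @ [?b]" s] w(2) by simp
    from has_value_two_moves[OF nov[OF w(1)] mv fw[OF w] walk_value_less this]
    show ?thesis by simp
  qed
  have at1: "has_value G S w (walk_value c (Suc d) a 1)"
    if w: "walk c w i a 1" "set w \<subseteq> carrier G" for w a
  proof -
    let ?b = "inv (forward (\<not> a))"
    obtain j where j: "i = Suc j" using w(1) unfolding walk_def by (cases i) auto
    have val: "word_value G w \<otimes> s = vertex i (\<not> a)"
      using w(1) unfolding walk_def by simp
    have mv: "moves G S w = {forward a, s}" using walk_moves[OF n S w(1)] by simp
    \<comment> \<open>The second rung is safe at once, but a step back in the new row hits the first
      rung's other end.\<close>
    have "\<not> game_over G (w @ [s])"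
      using w(1) j unfolding game_over_snoc val walk_def by simp
    moreover have "?b \<in> moves G S (w @ [s])"
      using moves_after(1)[OF n S, of w "\<not> a"] by simp
    moreover have "game_over G ((w @ [s]) @ [?b])"
      using w(1) j val vertex_backward[of j "\<not> a"] unfolding walk_def
      by (simp del: append_assoc)
    ultimately have "has_value G S (w @ [s]) 0" using closing[of "w @ [s]" ?b] w(2) by simp
    from has_value_two_moves[OF nov[OF w(1)] mv fw[OF w] walk_value_less this]
    show ?thesis by (simp add: numeral_2_eq_2)
  qed
  consider "t = 0" | "t = 1" | "t \<ge> 2" by linarith
  then show ?case
  proof cases
    case 3
    have mv: "moves G S w = {forward a, s}" using walk_moves[OF n S Suc.prems(1)] 3 by simp
    \<comment> \<open>A rung uses up no column, so \<open>at0\<close> at the same \<open>d\<close>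
      applies instead of the induction hypothesis.\<close>
    have "has_value G S (w @ [s]) (walk_value c (Suc d) (\<not> a) 0)"
      using at0[OF walk_rung[OF Suc.prems(1) 3]] Suc.prems(2) by simp
    from has_value_two_moves[OF nov[OF Suc.prems(1)] mv fw[OF Suc.prems(1,2)] walk_value_less this walk_value_less]
    have "has_value G S w (walk_value c (Suc d) a 2)"
      using walk_value_large[of "Suc t" c d a] 3 by (simp add: numeral_2_eq_2)
    then show ?thesis using walk_value_large 3 by metis
  qed (use at0 at1 Suc.prems in auto)
qed

section \<open>Periodicity of the recursion\<close>

lemma walk_value_two:
  "walk_value c (Suc d) a 2 = (max (walk_value c d a 2) ((walk_value c d (\<not> a) 1 + 1) mod 3) + 1) mod 3"
  by (simp add: numeral_2_eq_2)

text \<open>For \<open>t = 1\<close> and \<open>t = 2\<close> the recursion refers only to these two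
  \<open>t\<close>, so an induction by two columns closes.\<close>

lemma walk_value_True:
  "walk_value True (Suc (2 * k)) a 1 = 0 \<and> walk_value True (Suc (2 * k)) a 2 = 0 \<and>
   walk_value True (Suc (Suc (2 * k))) a 1 = 1 \<and> walk_value True (Suc (Suc (2 * k))) a 2 = 2"
proof (induction k arbitrary: a)
  case (Suc k)
  \<comment> \<open>An opaque \<open>d\<close> keeps the simplifier from unfolding past the
    induction hypothesis.\<close>
  define d where "d = Suc (Suc (2 * k))"
  have IH: "walk_value True d a (Suc 0) = 1" "walk_value True d a 2 = 2" for a
    using Suc.IH unfolding d_def by auto
  have "2 * Suc k = d" by (simp add: d_def)
  with IH show ?case by (auto simp: walk_value_two)
qed (auto simp: walk_value_two)

text \<open>Without an opening rung the two rows end differently in column 0, and they swap roles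
  every two columns; \<open>even k\<close> records the swap.\<close>

lemma walk_value_False:
  "walk_value False (Suc (2 * k)) a 1 = of_bool (a = even k) \<and>
   walk_value False (Suc (2 * k)) a 2 = of_bool (a = even k) \<and>
   walk_value False (Suc (Suc (2 * k))) a 1 = (if a = even k then 2 else 1) \<and>
   walk_value False (Suc (Suc (2 * k))) a 2 = (if a = even k then 2 else 0)"
proof (induction k arbitrary: a)
  case (Suc k)
  define d where "d = Suc (Suc (2 * k))"
  have IH: "walk_value False d a (Suc 0) = (if a = even k then 2 else 1)"
    "walk_value False d a 2 = (if a = even k then 2 else 0)" for a
    using Suc.IH unfolding d_def by auto
  have "2 * Suc k = d" by (simp add: d_def)
  with IH show ?case by (auto simp: walk_value_two)
qed (auto simp: walk_value_two)

section \<open>Openings and the value of the empty word\<close>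

lemma walk_start:
  assumes "n \<ge> 3"
  shows "walk True [s, inv r] 1 True 1" "walk False [r] 1 False 2"
proof -
  have s: "vertex 0 True = s" and r: "vertex 1 False = r" and sr: "s \<otimes> inv r = vertex 1 True"
    by (simp_all add: vertex_def s_inv_r)
  \<comment> \<open>With \<open>vertex_0\<close> switched off the identity stays visible as a
    vertex.\<close>
  have neq: "vertex 0 True \<noteq> vertex 0 False" "vertex 1 a \<noteq> vertex 0 b"
    "vertex 1 True \<noteq> vertex 1 False" for a b
    using assms by (simp_all add: vertex_eq_iff del: vertex_0)
  have far: "vertex j b \<noteq> vertex 0 a" "vertex j b \<noteq> vertex 1 a" if "1 < j" "j < n" for j a b
    using that by (simp_all add: vertex_eq_iff del: vertex_0)
  show "walk True [s, inv r] 1 True 1"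
  proof -
    have V1: "visited G [s] = {vertex 0 False, vertex 0 True}" and W1: "word_value G [s] = s"
      using visited_snoc[of G "[]" s] word_value_snoc[of G "[]" s] s by auto
    have V: "visited G [s, inv r] = {vertex 0 False, vertex 0 True, vertex 1 True}"
      and W: "word_value G [s, inv r] = vertex 1 True"
      using visited_snoc[of G "[s]" "inv r"] word_value_snoc[of G "[s]" "inv r"] V1 W1 s sr by auto
    have "\<not> game_over G [s, inv r]"
      using game_over_snoc[of G "[s]" "inv r"] V1 W1 sr neq by (simp del: vertex_0)
    then show ?thesis
      unfolding walk_def V W using assms neq far
      by (auto simp: forward_def simp del: vertex_0 intro: exI[of _ "[s]"])
  qed
  \<comment> \<open>No rung was played, so \<open>t\<close> takes its default 2.\<close>
  show "walk False [r] 1 False 2"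
  proof -
    have V: "visited G [r] = {vertex 0 False, vertex 1 False}"
      and W: "word_value G [r] = vertex 1 False"
      using visited_snoc[of G "[]" r] word_value_snoc[of G "[]" r] r by auto
    have "\<not> game_over G [r]"
      using game_over_snoc[of G "[]" r] r neq(2)[of False False] by simp
    then show ?thesis
      unfolding walk_def V W using assms neq neq(2)[symmetric] far
      by (auto simp: forward_def simp del: vertex_0)
  qed
qed

text \<open>Both walks stand in column 1 with \<open>n - 1\<close> columns left. For odd
  \<open>n\<close> the opening \<open>s\<close> already wins, so \<open>[r]\<close> is evaluated for
  even \<open>n\<close> only.\<close>

lemma has_value_start:
  assumes n: "n \<ge> 3" and S: "S \<union> (\<lambda>y. inv y) ` S = {r, inv r, s}"
  shows "has_value G S [s, inv r] (if odd n then 1 else 0)"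
    and "even n \<Longrightarrow> \<exists>v\<le>1. has_value G S [r] v"
proof -
  have "has_value G S [s, inv r] (walk_value True (n - 1) True 1)"
    using has_value_walk[OF n S walk_start(1)[OF n], of "n - 1"] n by auto
  moreover have "walk_value True (n - 1) True 1 = (if odd n then 1 else 0)"
  proof (cases "odd n")
    case True
    with n have "\<exists>k. n - 1 = Suc (Suc (2 * k))"
      by presburger
    then obtain k where "n - 1 = Suc (Suc (2 * k))"
      by blast
    then show ?thesis using True walk_value_True by simp
  next
    case False
    with n have "\<exists>k. n - 1 = Suc (2 * k)"
      by presburger
    then obtain k where "n - 1 = Suc (2 * k)"
      by blast
    then show ?thesis using False walk_value_True by simp
  qed
  ultimately show "has_value G S [s, inv r] (if odd n then 1 else 0)" by simp
  assume "even n"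
  with n have "\<exists>k. n - 1 = Suc (2 * k)"
    by presburger
  then obtain k where k: "n - 1 = Suc (2 * k)"
    by blast
  have "has_value G S [r] (walk_value False (n - 1) False 2)"
    using has_value_walk[OF n S walk_start(2)[OF n], of "n - 1"] n by auto
  moreover have "walk_value False (n - 1) False 2 \<le> 1"
    unfolding k using walk_value_False[of k False] by simp
  ultimately show "\<exists>v\<le>1. has_value G S [r] v" by blast
qed

lemma has_value_Nil:
  assumes n: "n \<ge> 3" and S: "S \<union> (\<lambda>y. inv y) ` S = {r, inv r, s}"
  shows "has_value G S [] (if odd n then 0 else 2)"
proof -
  \<comment> \<open>Covers the mirrored openings \<open>[s, r]\<close> and
    \<open>[inv r]\<close>.\<close>
  interpret inv: dihedral_group G n "inv r" s
    by (rule dihedral_group_inv)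
  have S': "S \<union> (\<lambda>y. inv y) ` S = {inv r, inv (inv r), s}"
    using S by (simp add: insert_commute[of r])
  have nov: "\<not> game_over G [s]"
    using game_over_snoc[of G "[]" s] vertex_eq_iff[of 0 0 True False] n
    by (simp add: vertex_def)
  have mv: "moves G S [s] = {r, inv r}"
    using moves_after(1)[OF n S, of "[]" False] by (simp add: forward_def)
  have s: "has_value G S [s] (if odd n then 2 else 1)"
    using has_value_two_moves[OF nov mv, of "if odd n then 1 else 0" "if odd n then 1 else 0"]
      has_value_start(1)[OF n S] inv.has_value_start(1)[OF n S']
    by (cases "odd n") (auto simp: numeral_2_eq_2)
  have mv0: "moves G S [] = {r, inv r, s}" using moves_Nil[OF S] .
  show ?thesis
  proof (cases "odd n")
    case True
    then show ?thesis
      using has_value_winning[OF n S, of "[]" s] s mv0 by simp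
  next
    case False
    \<comment> \<open>No opening wins for Player 1; \<open>s\<close>, with value 1, secures second
      place by letting Player 3 win.\<close>
    have "\<exists>u\<le>1. has_value G S ([] @ [y]) u" if "y \<in> moves G S []" for y
      using that s False has_value_start(2)[OF n S] inv.has_value_start(2)[OF n S']
      unfolding mv0 by auto
    then show ?thesis
      using has_value_step[of G "[]" s S 1] s False mv0
      by (simp add: numeral_2_eq_2)
  qed
qed

end

theorem theorem6p2:
  fixes G :: "('a, 'b) monoid_scheme" and n :: nat and r s :: 'a
  assumes "n \<ge> 3"
    and "dihedral_group G n r s"
  shows "(odd n \<longrightarrow> has_winning_strategy G {r, s} 1) \<and>
         (even n \<longrightarrow> has_winning_strategy G {r, s} 3)"
proof -
  interpret dihedral_group G n r s by fact
  have S: "{r, s} \<union> (\<lambda>y. inv\<^bsub>G\<^esub> y) ` {r, s} = {r, inv\<^bsub>G\<^esub> r, s}"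
    by auto
  let ?p = "if odd n then 1 else 3 :: nat"
  \<comment> \<open>Player 1 moves first, so relative values 0 and 2 denote Players 1 and 3.\<close>
  have "(length ([] :: 'a list) + (if odd n then 0 else 2)) mod 3 + 1 = ?p"
    by simp
  then have "best_play G {r, s} [] ?p"
    using has_value_Nil[OF assms(1) S] unfolding has_value_def by (simp only:)
  moreover have "finite (carrier G)"
    using finite_carrier assms(1) by linarith
  ultimately have "wins_with G {r, s} ?p (\<lambda>w. SOME x. x \<in> best_moves G {r, s} w) []"
    by (intro best_play_imp_wins_with letters_closed[OF S]) simp_all
  then have "has_winning_strategy G {r, s} ?p"
    unfolding has_winning_strategy_def by blast
  then show ?thesis by (cases "odd n") auto
qed

end
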